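(* Let $G$ be a graph with $n\geq 3$ vertices and let $F=\sum_{i=1}^n d_i^3$. Then $$2\sqrt{F}\leq \mathcal{E}(G)\leq \sqrt{2nF}.$$ The equality in the right hand side holds if and only if $G\cong \overline{K_n}$ (the edgeless graph) or $G\cong \frac{n}{2}K_2$ (a perfect matching). If $G$ is connected, then the equality in the left hand side holds if and only if $G\cong K_{s,t}$ with $s+t=n$.
   Context: $G$ is a simple undirected graph on vertices $v_1,\dots,v_n$ with degrees $d_i$. The Sombor matrix $\mathcal{S}(G)$ has $(i,j)$-entry $\sqrt{d_i^2+d_j^2}$ if $v_i,v_j$ are adjacent and $0$ otherwise, with eigenvalues $\rho_1,\dots,\rho_n$. The Sombor energy is $\mathcal{E}(G)=\sum_{i=1}^n|\rho_i|$. $K_{s,t}$ is the complete bipartite graph. *)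

theory Defs
  imports "Jordan_Normal_Form.Char_Poly" "Graph_Theory.Graph_Theory"
begin

text \<open>
  Finite simple undirected graphs are rendered by the locale predicate \<^const>\<open>graph\<close>: finite,
  loop-free, symmetric digraphs without parallel arcs. An undirected edge is a pair of opposite
  arcs, so the degree of a vertex is its \<^const>\<open>out_degree\<close>.

  The list \<open>vs\<close> below enumerates the vertices; it fixes the order of rows and columns.
\<close>

definition sombor_mat :: "('a, 'b) pre_digraph \<Rightarrow> 'a list \<Rightarrow> real mat" where
  "sombor_mat G vs = mat (length vs) (length vs) (\<lambda>(i, j).
     if vs ! i \<rightarrow>\<^bsub>G\<^esub> vs ! j
     then sqrt ((real (out_degree G (vs ! i)))\<^sup>2 + (real (out_degree G (vs ! j)))\<^sup>2)
     else 0)"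

text \<open>
  Eigenvalues with multiplicity. Taking real roots only loses nothing, since the matrix is
  symmetric: see \<open>size_sombor_eigenvalues\<close> below.
\<close>

definition sombor_eigenvalues :: "('a, 'b) pre_digraph \<Rightarrow> 'a list \<Rightarrow> real multiset" where
  "sombor_eigenvalues G vs = proots (char_poly (sombor_mat G vs))"

definition sombor_energy :: "('a, 'b) pre_digraph \<Rightarrow> 'a list \<Rightarrow> real" where
  "sombor_energy G vs = (\<Sum>\<rho>\<in>#sombor_eigenvalues G vs. \<bar>\<rho>\<bar>)"

definition edgeless_graph :: "nat \<Rightarrow> nat pair_pre_digraph" where
  "edgeless_graph n = \<lparr> pverts = {..<n}, parcs = {} \<rparr>"

definition copies_K2 :: "nat \<Rightarrow> (nat \<times> bool) pair_pre_digraph" where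
  "copies_K2 m = \<lparr> pverts = {..<m} \<times> UNIV,
     parcs = {((k, a), (k, b)) | k a b. k < m \<and> a \<noteq> b} \<rparr>"

lemma sombor_mat_carrier: "sombor_mat G vs \<in> carrier_mat (length vs) (length vs)"
  by (simp add: sombor_mat_def)

lemma symmetric_mat_eigenvalue_real:
  fixes A :: "real mat" and k :: complex
  assumes A: "A \<in> carrier_mat n n"
    and sym: "\<And>i j. i < n \<Longrightarrow> j < n \<Longrightarrow> A $$ (i, j) = A $$ (j, i)"
    and k: "eigenvalue (map_mat complex_of_real A) k"
  shows "k \<in> \<real>"
proof -
  from k A obtain v where v: "dim_vec v = n" "v \<noteq> 0\<^sub>v n"
    and ev: "map_mat complex_of_real A *\<^sub>v v = k \<cdot>\<^sub>v v"
    unfolding eigenvalue_def eigenvector_def by (auto dest: carrier_vecD)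
  define q where "q = (\<Sum>i<n. cnj (v $ i) * (v $ i))"
  have ev_i: "(\<Sum>j<n. of_real (A $$ (i, j)) * v $ j) = k * v $ i" if "i < n" for i
    using arg_cong[OF ev, of "\<lambda>w. w $ i"] that A v
    by (simp add: scalar_prod_def lessThan_atLeast0)
  have form: "(\<Sum>i<n. \<Sum>j<n. cnj (v $ i) * of_real (A $$ (i, j)) * v $ j) = k * q"
  proof -
    have "(\<Sum>i<n. \<Sum>j<n. cnj (v $ i) * of_real (A $$ (i, j)) * v $ j)
        = (\<Sum>i<n. cnj (v $ i) * (k * v $ i))"
      by (intro sum.cong refl) (simp add: ev_i[symmetric] sum_distrib_left mult.assoc)
    thus ?thesis by (simp add: q_def sum_distrib_left mult.left_commute)
  qed
  have q_real: "cnj q = q" by (simp add: q_def mult.commute)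
  have "cnj (k * q) = (\<Sum>i<n. \<Sum>j<n. cnj (v $ j) * of_real (A $$ (i, j)) * v $ i)"
    unfolding form[symmetric] by (simp add: mult_ac)
  also have "\<dots> = (\<Sum>j<n. \<Sum>i<n. cnj (v $ j) * of_real (A $$ (i, j)) * v $ i)"
    by (rule sum.swap)
  also have "\<dots> = k * q"
    unfolding form[symmetric] by (intro sum.cong refl) (simp add: sym)
  finally have eq: "cnj k * q = k * q" by (simp add: q_real)
  have "q = of_real (\<Sum>i<n. (cmod (v $ i))\<^sup>2)"
    unfolding q_def of_real_sum by (simp add: complex_norm_square mult.commute del: of_real_power)
  moreover have "(\<Sum>i<n. (cmod (v $ i))\<^sup>2) \<noteq> 0"
  proof
    assume "(\<Sum>i<n. (cmod (v $ i))\<^sup>2) = 0"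
    hence "v = 0\<^sub>v n" using v by (intro eq_vecI) (auto simp: sum_nonneg_eq_0_iff)
    with v show False by simp
  qed
  ultimately have "q \<noteq> 0" by (metis of_real_eq_0_iff)
  with eq show ?thesis by (simp add: Reals_cnj_iff)
qed

lemma char_poly_symmetric_mat_splits:
  fixes A :: "real mat"
  assumes A: "A \<in> carrier_mat n n"
    and sym: "\<And>i j. i < n \<Longrightarrow> j < n \<Longrightarrow> A $$ (i, j) = A $$ (j, i)"
  obtains rs where "char_poly A = (\<Prod>r\<leftarrow>rs. [:- r, 1:])" and "length rs = n"
proof -
  interpret ph: map_poly_comm_ring_hom complex_of_real ..
  let ?B = "map_mat complex_of_real A"
  have B: "?B \<in> carrier_mat n n" using A by simp
  from char_poly_factorized[OF B] obtain as where
    as: "char_poly ?B = (\<Prod>a\<leftarrow>as. [:- a, 1:])" "length as = n" by blast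
  define rs where "rs = map Re as"
  have "a \<in> \<real>" if "a \<in> set as" for a
  proof (rule symmetric_mat_eigenvalue_real[OF A sym])
    show "eigenvalue ?B a"
      using that by (subst eigenvalue_root_char_poly[OF B])
        (auto simp: as poly_prod_list prod_list_zero_iff)
  qed
  hence as_rs: "as = map of_real rs"
    by (simp add: rs_def map_idI complex_eq_iff complex_is_Real_iff)
  have "map_poly complex_of_real (char_poly A) = char_poly ?B"
    by (simp add: of_real_hom.char_poly_hom[OF A])
  also have "\<dots> = map_poly of_real (\<Prod>r\<leftarrow>rs. [:- r, 1:])"
    unfolding as as_rs by (induction rs)
      (simp_all add: ph.hom_mult ph.map_poly_pCons_hom del: mult_pCons_left)
  finally have "char_poly A = (\<Prod>r\<leftarrow>rs. [:- r, 1:])"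
    by (simp add: poly_eq_iff coeff_map_poly)
  moreover have "length rs = n" using as(2) by (simp add: rs_def)
  ultimately show ?thesis by (rule that)
qed

lemma size_sombor_eigenvalues:
  assumes "graph G"
  shows "size (sombor_eigenvalues G vs) = length vs"
proof -
  interpret graph G by fact
  have sym: "sombor_mat G vs $$ (i, j) = sombor_mat G vs $$ (j, i)"
    if "i < length vs" "j < length vs" for i j
    using that arcs_ends_symmetric[OF sym_arcs] by (auto simp: sombor_mat_def add.commute)
  from char_poly_symmetric_mat_splits[OF sombor_mat_carrier sym] obtain rs where
    rs: "char_poly (sombor_mat G vs) = (\<Prod>r\<leftarrow>rs. [:- r, 1:])" "length rs = length vs" by blast
  have "proots (\<Prod>r\<leftarrow>rs. [:- r, 1:]) = mset rs"
  proof (induction rs)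
    case (Cons r rs)
    have "(\<Prod>r\<leftarrow>rs. [:- r, 1:]) \<noteq> 0" by (auto simp: prod_list_zero_iff)
    hence "proots ([:- r, 1:] * (\<Prod>r\<leftarrow>rs. [:- r, 1:])) = mset (r # rs)"
      by (subst proots_mult) (simp_all add: Cons)
    thus ?case by (simp only: list.map prod_list.Cons)
  qed simp
  with rs show ?thesis by (simp add: sombor_eigenvalues_def)
qed

end

theory Submission
  imports Defs "Jordan_Normal_Form.Schur_Decomposition"
begin

text \<open>
  Let \<open>S\<close> be the Sombor matrix with eigenvalues \<open>\<rho>\<^sub>i\<close> and energy \<open>E\<close>. Then \<open>\<Sum> \<rho>\<^sub>i = tr S = 0\<close> and
  \<open>\<Sum> \<rho>\<^sub>i\<^sup>2 = tr S\<^sup>2 = 2F\<close>. The upper bound is the Cauchy-Schwarz inequality, with equality iff all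
  \<open>\<rho>\<^sub>i\<^sup>2 = 2F/n\<close>, that is, \<open>S\<^sup>2 = (2F/n) I\<close>. For the lower bound, \<open>\<Sum> \<rho>\<^sub>i = 0\<close> gives
  \<open>\<bar>\<rho>\<^sub>i\<bar> \<le> E/2\<close>, so \<open>0 \<le> \<Sum> \<bar>\<rho>\<^sub>i\<bar> (E/2 - \<bar>\<rho>\<^sub>i\<bar>) = E\<^sup>2/2 - 2F\<close>, with equality iff all
  \<open>\<rho>\<^sub>i\<^sup>3 = F \<rho>\<^sub>i\<close>, that is, \<open>S\<^sup>3 = F S\<close>.

  Since the entries of \<open>S\<close> are nonnegative, with positive ones exactly at edges, both matrix equations
  are read off walks. If \<open>S\<^sup>2\<close> is scalar, no vertex has two neighbours, and
  either all vertices or none have a neighbour. If \<open>S\<^sup>3 = F S\<close>, the ends of every walk of length 3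
  are adjacent (in particular there are no triangles), and for any edge \<open>xy\<close> of a connected graph
  the neighbourhoods of \<open>y\<close> and \<open>x\<close> are the two sides of a complete bipartite graph.
\<close>

section \<open>Traces of matrix powers as power sums of eigenvalues\<close>

definition mat_trace :: "'a::comm_monoid_add mat \<Rightarrow> 'a" where
  "mat_trace A = (\<Sum>i<dim_row A. A $$ (i, i))"

lemma index_mult_mat_sum:
  assumes "A \<in> carrier_mat m n" "B \<in> carrier_mat n p" "i < m" "j < p"
  shows "(A * B) $$ (i, j) = (\<Sum>k<n. A $$ (i, k) * B $$ (k, j))"
  using assms by (auto simp: scalar_prod_def lessThan_atLeast0)

lemma mat_trace_mult_commute:
  fixes A :: "'a::comm_semiring_0 mat"
  assumes A: "A \<in> carrier_mat m n" and B: "B \<in> carrier_mat n m"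
  shows "mat_trace (A * B) = mat_trace (B * A)"
proof -
  have "mat_trace (A * B) = (\<Sum>i<m. \<Sum>k<n. A $$ (i, k) * B $$ (k, i))"
    using A by (simp add: mat_trace_def index_mult_mat_sum[OF A B] del: index_mult_mat(1))
  also have "\<dots> = (\<Sum>k<n. \<Sum>i<m. B $$ (k, i) * A $$ (i, k))"
    by (subst sum.swap) (simp add: mult.commute)
  also have "\<dots> = mat_trace (B * A)"
    using B by (simp add: mat_trace_def index_mult_mat_sum[OF B A] del: index_mult_mat(1))
  finally show ?thesis .
qed

lemma mat_trace_similar:
  fixes A :: "'a::comm_ring_1 mat"
  assumes "similar_mat_wit A B P Q"
  shows "mat_trace A = mat_trace B"
proof -
  define n where "n = dim_row A"
  have A: "A \<in> carrier_mat n n"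
    using assms unfolding similar_mat_wit_def Let_def n_def by blast
  note D = similar_mat_witD2[OF A assms]
  have "mat_trace A = mat_trace (P * B * Q)" by (rule arg_cong[OF D(3)])
  also have "\<dots> = mat_trace (Q * (P * B))"
    by (rule mat_trace_mult_commute[OF mult_carrier_mat[OF D(6,5)] D(7)])
  also have "Q * (P * B) = B"
    using assoc_mult_mat[OF D(7,6,5)] D(2,5) by simp
  finally show ?thesis .
qed

text \<open>A summand with a factor below the diagonal vanishes, so on the diagonal only the middle
  index \<open>i\<close> survives. Both claims share one induction because the diagonal claim for
  \<open>Suc k\<close> uses that \<open>B ^\<^sub>m k\<close> is triangular.\<close>

lemma upper_triangular_pow_mat:
  fixes B :: "'a::comm_semiring_1 mat"
  assumes B: "B \<in> carrier_mat n n" and tri: "upper_triangular B"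
  shows "upper_triangular (B ^\<^sub>m k) \<and> (\<forall>i<n. (B ^\<^sub>m k) $$ (i, i) = (B $$ (i, i)) ^ k)"
proof (induction k)
  case 0
  show ?case using B by auto
next
  case (Suc k)
  have C: "B ^\<^sub>m k \<in> carrier_mat n n" using B by simp
  have z: "(B ^\<^sub>m k) $$ (i, l) * B $$ (l, j) = 0" if "i < n" "l < n" "l < i \<or> j < l" for i j l
    using that Suc tri B C upper_triangularD[of "B ^\<^sub>m k" l i] upper_triangularD[of B j l]
    by auto
  have "upper_triangular (B ^\<^sub>m Suc k)"
  proof (rule upper_triangularI)
    fix i j assume "j < i" "i < dim_row (B ^\<^sub>m Suc k)"
    then have ij: "j < i" "i < n" using B by auto
    have "(B ^\<^sub>m Suc k) $$ (i, j) = (\<Sum>l<n. (B ^\<^sub>m k) $$ (i, l) * B $$ (l, j))"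
      using ij index_mult_mat_sum[OF C B] by simp
    also have "\<dots> = 0"
      using ij by (intro sum.neutral ballI z) auto
    finally show "(B ^\<^sub>m Suc k) $$ (i, j) = 0" .
  qed
  moreover have "(B ^\<^sub>m Suc k) $$ (i, i) = (B $$ (i, i)) ^ Suc k" if "i < n" for i
  proof -
    have "(B ^\<^sub>m Suc k) $$ (i, i) = (\<Sum>l<n. (B ^\<^sub>m k) $$ (i, l) * B $$ (l, i))"
      using that index_mult_mat_sum[OF C B] by simp
    also have "\<dots> = (\<Sum>l\<in>{i}. (B ^\<^sub>m k) $$ (i, l) * B $$ (l, i))"
      using that by (intro sum.mono_neutral_right ballI z) auto
    finally show ?thesis using that Suc by (simp add: mult.commute)
  qed
  ultimately show ?case by blast
qed

text \<open>Schur decomposition gives a similar triangular matrix with diagonal \<open>es\<close>.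
  Powers preserve the similarity and raise the diagonal entries to the same power, and similar
  matrices have equal traces.\<close>

lemma mat_trace_pow_mat_eq_sum_eigenvalues:
  fixes A :: "'a::conjugatable_ordered_field mat"
  assumes A: "A \<in> carrier_mat n n" and es: "char_poly A = (\<Prod>e\<leftarrow>es. [:- e, 1:])"
  shows "mat_trace (A ^\<^sub>m k) = (\<Sum>e\<leftarrow>es. e ^ k)"
proof -
  obtain B P Q where "schur_decomposition A es = (B, P, Q)" by (metis prod_cases3)
  from schur_decomposition[OF A es this]
  have sim: "similar_mat_wit A B P Q" and tri: "upper_triangular B" and diag: "diag_mat B = es"
    by auto
  have B: "B \<in> carrier_mat n n" using similar_mat_witD2[OF A sim] by auto
  have "mat_trace (A ^\<^sub>m k) = mat_trace (B ^\<^sub>m k)"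
    by (rule mat_trace_similar[OF similar_mat_wit_pow[OF sim]])
  also have "\<dots> = (\<Sum>i<n. (B $$ (i, i)) ^ k)"
    using upper_triangular_pow_mat[OF B tri, of k] B by (simp add: mat_trace_def)
  also have "\<dots> = (\<Sum>e\<leftarrow>es. e ^ k)"
    using B by (simp add: diag[symmetric] diag_mat_def sum_list_sum_nth lessThan_atLeast0)
  finally show ?thesis .
qed

lemma pow_mat_add:
  fixes A :: "'a::semiring_1 mat"
  assumes A: "A \<in> carrier_mat n n"
  shows "A ^\<^sub>m (p + q) = A ^\<^sub>m p * A ^\<^sub>m q"
proof (induction q)
  case 0
  show ?case using A by simp
next
  case (Suc q)
  then show ?case
    using A by (simp add: assoc_mult_mat[of _ n n _ n _ n])
qed

lemma symmetric_pow_mat: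
  fixes A :: "'a::comm_semiring_1 mat"
  assumes A: "A \<in> carrier_mat n n" and sym: "A\<^sup>T = A"
  shows "(A ^\<^sub>m k)\<^sup>T = A ^\<^sub>m k"
proof (induction k)
  case 0
  show ?case using A by simp
next
  case (Suc k)
  have "(A ^\<^sub>m Suc k)\<^sup>T = A * A ^\<^sub>m k"
    using A sym Suc by (simp add: transpose_mult[of _ n n _ n])
  \<comment> \<open>Transposition has put the extra factor on the left; \<open>1 + k\<close> and
    \<open>k + 1\<close> split the same power, so it may move to the right.\<close>
  also have "\<dots> = A ^\<^sub>m Suc k"
    using pow_mat_add[OF A, of 1 k] pow_mat_add[OF A, of k 1] A by simp
  finally show ?case .
qed

text \<open>By symmetry of the second power, the entrywise inner product is the trace of the
  product. Such inner products are the terms in the expanded Frobenius norm of a combination of two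
  powers.\<close>

lemma sum_entries_symmetric_pow_mat:
  fixes A :: "real mat"
  assumes A: "A \<in> carrier_mat n n" and sym: "A\<^sup>T = A"
    and es: "char_poly A = (\<Prod>e\<leftarrow>es. [:- e, 1:])"
  shows "(\<Sum>i<n. \<Sum>j<n. (A ^\<^sub>m p) $$ (i, j) * (A ^\<^sub>m q) $$ (i, j)) = (\<Sum>e\<leftarrow>es. e ^ p * e ^ q)"
proof -
  have c: "A ^\<^sub>m k \<in> carrier_mat n n" for k using A by simp
  have s: "(A ^\<^sub>m q) $$ (i, j) = (A ^\<^sub>m q) $$ (j, i)" if "i < n" "j < n" for i j
    using arg_cong[OF symmetric_pow_mat[OF A sym, of q], of "\<lambda>M. M $$ (i, j)"] that A by simp
  have "(\<Sum>i<n. \<Sum>j<n. (A ^\<^sub>m p) $$ (i, j) * (A ^\<^sub>m q) $$ (i, j)) = mat_trace (A ^\<^sub>m p * A ^\<^sub>m q)"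
    using A by (simp add: mat_trace_def index_mult_mat_sum[OF c c] s del: index_mult_mat(1))
  also have "\<dots> = (\<Sum>e\<leftarrow>es. e ^ p * e ^ q)"
    by (simp add: mat_trace_pow_mat_eq_sum_eigenvalues[OF A es] power_add
        flip: pow_mat_add[OF A])
  finally show ?thesis .
qed

text \<open>
  Both sides say that a sum of squares vanishes: the squared Frobenius norm of
  \<open>A\<^sup>p - c A\<^sup>q\<close> is the trace of its square, which is the sum of \<open>(e\<^sup>p - c e\<^sup>q)\<^sup>2\<close>.
  This replaces diagonalisation.
\<close>

lemma symmetric_pow_mat_eq_iff:
  fixes A :: "real mat"
  assumes A: "A \<in> carrier_mat n n" and sym: "A\<^sup>T = A"
    and es: "char_poly A = (\<Prod>e\<leftarrow>es. [:- e, 1:])"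
  shows "(\<forall>i<n. \<forall>j<n. (A ^\<^sub>m p) $$ (i, j) = c * (A ^\<^sub>m q) $$ (i, j)) \<longleftrightarrow>
    (\<forall>e\<in>set es. e ^ p = c * e ^ q)"
proof -
  let ?d = "\<lambda>i j. (A ^\<^sub>m p) $$ (i, j) - c * (A ^\<^sub>m q) $$ (i, j)"
  let ?s = "\<lambda>p q. \<Sum>i<n. \<Sum>j<n. (A ^\<^sub>m p) $$ (i, j) * (A ^\<^sub>m q) $$ (i, j)"
  have "(\<Sum>i<n. \<Sum>j<n. (?d i j)\<^sup>2) = ?s p p - 2 * c * ?s p q + c\<^sup>2 * ?s q q"
    by (simp add: power2_eq_square algebra_simps sum.distrib sum_subtractf sum_distrib_left)
  also have "\<dots> = (\<Sum>e\<leftarrow>es. (e ^ p - c * e ^ q)\<^sup>2)"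
    unfolding sum_entries_symmetric_pow_mat[OF A sym es]
    by (induction es) (simp_all add: power2_eq_square algebra_simps)
  finally have eq: "(\<Sum>i<n. \<Sum>j<n. (?d i j)\<^sup>2) = (\<Sum>e\<leftarrow>es. (e ^ p - c * e ^ q)\<^sup>2)" .
  have "(\<forall>i<n. \<forall>j<n. ?d i j = 0) \<longleftrightarrow> (\<Sum>i<n. \<Sum>j<n. (?d i j)\<^sup>2) = 0"
    by (simp add: sum_nonneg_eq_0_iff sum_nonneg Ball_def)
  also have "\<dots> \<longleftrightarrow> (\<forall>e\<in>set es. e ^ p - c * e ^ q = 0)"
    unfolding eq by (subst sum_list_nonneg_eq_0_iff) auto
  finally show ?thesis by simp
qed

section \<open>Sums of absolute values of real lists with prescribed power sums\<close>

lemma proots_prod_list_linear: "proots (\<Prod>r\<leftarrow>rs. [:- r, 1:]) = mset (rs :: 'a::idom list)"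
proof (induction rs)
  case (Cons r rs)
  have "(\<Prod>r\<leftarrow>rs. [:- r, 1:]) \<noteq> 0" by (auto simp: prod_list_zero_iff)
  then have "proots ([:- r, 1:] * (\<Prod>r\<leftarrow>rs. [:- r, 1:])) = mset (r # rs)"
    by (subst proots_mult) (simp_all add: Cons)
  then show ?case by (simp only: list.map prod_list.Cons)
qed simp

text \<open>Cauchy-Schwarz as a variance: the squared deviations of \<open>n * |r|\<close> from
  \<open>?E\<close> add up to \<open>n * (2 * n * F - ?E^2)\<close>. Hence equality holds exactly
  when every |r| is the mean. Scaling by \<open>n\<close> avoids division.\<close>

lemma sum_list_abs_le_sqrt:
  fixes rs :: "real list"
  assumes n: "length rs = n" "n > 0"
    and sq: "(\<Sum>r\<leftarrow>rs. r\<^sup>2) = 2 * F"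
  shows "(\<Sum>r\<leftarrow>rs. \<bar>r\<bar>) \<le> sqrt (2 * real n * F)" (is "?E \<le> _")
    and "(\<Sum>r\<leftarrow>rs. \<bar>r\<bar>) = sqrt (2 * real n * F) \<longleftrightarrow> (\<forall>r\<in>set rs. r\<^sup>2 = 2 * F / real n)"
proof -
  \<comment> \<open>Here \<open>c\<close> stands for \<open>?E\<close>, and \<open>length rs\<close>
    for the last \<open>n\<close>, since the induction changes the list on which both depend; the
    other \<open>n\<close> are mere scalars.\<close>
  have expand: "(\<Sum>r\<leftarrow>rs. (real n * \<bar>r\<bar> - c)\<^sup>2) =
      (real n)\<^sup>2 * (\<Sum>r\<leftarrow>rs. r\<^sup>2) - 2 * real n * c * (\<Sum>r\<leftarrow>rs. \<bar>r\<bar>) + real (length rs) * c\<^sup>2" for c :: real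
    by (induction rs) (simp_all add: power2_diff power_mult_distrib algebra_simps)
  have dev: "(\<Sum>r\<leftarrow>rs. (real n * \<bar>r\<bar> - ?E)\<^sup>2) = real n * (2 * real n * F - ?E\<^sup>2)"
    unfolding expand sq using n(1) by (simp add: power2_eq_square algebra_simps)
  have "(\<Sum>r\<leftarrow>rs. (real n * \<bar>r\<bar> - ?E)\<^sup>2) \<ge> 0" by (intro sum_list_nonneg) auto
  then have le: "?E\<^sup>2 \<le> 2 * real n * F" using n(2) by (simp add: dev zero_le_mult_iff)
  then show "?E \<le> sqrt (2 * real n * F)" by (rule real_le_rsqrt)
  have F0: "0 \<le> F"
  proof -
    have "(\<Sum>r\<leftarrow>rs. r\<^sup>2) \<ge> 0" by (intro sum_list_nonneg) auto
    then show ?thesis by (simp add: sq)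
  qed
  show "?E = sqrt (2 * real n * F) \<longleftrightarrow> (\<forall>r\<in>set rs. r\<^sup>2 = 2 * F / real n)"
  proof
    assume E: "?E = sqrt (2 * real n * F)"
    then have E2: "?E\<^sup>2 = 2 * real n * F" using F0 by simp
    then have "(\<Sum>r\<leftarrow>rs. (real n * \<bar>r\<bar> - ?E)\<^sup>2) = 0" by (simp add: dev)
    then have "\<forall>r\<in>set rs. real n * \<bar>r\<bar> = ?E"
      by (subst (asm) sum_list_nonneg_eq_0_iff) auto
    then have "\<forall>r\<in>set rs. (real n)\<^sup>2 * r\<^sup>2 = 2 * real n * F"
      by (metis E2 power2_abs power_mult_distrib)
    then show "\<forall>r\<in>set rs. r\<^sup>2 = 2 * F / real n"
      using n(2) by (simp add: power2_eq_square field_simps)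
  next
    assume "\<forall>r\<in>set rs. r\<^sup>2 = 2 * F / real n"
    then have "\<forall>r\<in>set rs. \<bar>r\<bar> = sqrt (2 * F / real n)" by (metis real_sqrt_abs)
    then have "?E = (\<Sum>r\<leftarrow>rs. sqrt (2 * F / real n))" by (intro arg_cong[of _ _ sum_list] map_cong) auto
    also have "\<dots> = real n * sqrt (2 * F / real n)" by (simp add: sum_list_triv n)
    also have "\<dots> = sqrt (2 * real n * F)"
      using n(2) F0 by (intro real_sqrt_unique[symmetric]) (auto simp: power_mult_distrib power2_eq_square[of "real n"])
    finally show "?E = sqrt (2 * real n * F)" .
  qed
qed

lemma sum_list_abs_ge_sqrt:
  fixes rs :: "real list"
  assumes zero: "(\<Sum>r\<leftarrow>rs. r) = 0" and sq: "(\<Sum>r\<leftarrow>rs. r\<^sup>2) = 2 * F"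
  shows "2 * sqrt F \<le> (\<Sum>r\<leftarrow>rs. \<bar>r\<bar>)" (is "_ \<le> ?E")
    and "2 * sqrt F = (\<Sum>r\<leftarrow>rs. \<bar>r\<bar>) \<longleftrightarrow> (\<forall>r\<in>set rs. r ^ 3 = F * r)"
proof -
  have E0: "?E \<ge> 0" by (intro sum_list_nonneg) auto
  have F0: "F \<ge> 0"
  proof -
    have "(\<Sum>r\<leftarrow>rs. r\<^sup>2) \<ge> 0" by (intro sum_list_nonneg) auto
    then show ?thesis by (simp add: sq)
  qed
  \<comment> \<open>The entries add up to zero, so \<open>r\<close> is minus the sum of the others
    and |r| is at most \<open>?E - |r|\<close>. Exactly one occurrence of \<open>r\<close> is split
    off, so repeated entries do no harm.\<close>
  have half: "\<bar>r\<bar> \<le> ?E / 2" if r: "r \<in> set rs" for r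
  proof -
    obtain xs ys where rs: "rs = xs @ r # ys" using split_list[OF r] by blast
    have "r = - (sum_list xs + sum_list ys)" using zero by (simp add: rs)
    then have "\<bar>r\<bar> \<le> \<bar>sum_list xs\<bar> + \<bar>sum_list ys\<bar>" by simp
    also have "\<dots> \<le> (\<Sum>r\<leftarrow>xs. \<bar>r\<bar>) + (\<Sum>r\<leftarrow>ys. \<bar>r\<bar>)" by (intro add_mono sum_list_abs)
    also have "\<dots> = ?E - \<bar>r\<bar>" by (simp add: rs)
    finally show ?thesis by simp
  qed
  have expand: "(\<Sum>r\<leftarrow>rs. \<bar>r\<bar> * (c - \<bar>r\<bar>)) = c * (\<Sum>r\<leftarrow>rs. \<bar>r\<bar>) - (\<Sum>r\<leftarrow>rs. r\<^sup>2)" for c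
    by (induction rs) (simp_all add: power2_eq_square algebra_simps)
  have dev: "(\<Sum>r\<leftarrow>rs. \<bar>r\<bar> * (?E / 2 - \<bar>r\<bar>)) = (?E\<^sup>2 - 4 * F) / 2"
    unfolding expand sq by (simp add: power2_eq_square field_simps)
  have "(\<Sum>r\<leftarrow>rs. \<bar>r\<bar> * (?E / 2 - \<bar>r\<bar>)) \<ge> 0"
    using half by (intro sum_list_nonneg) auto
  then have le: "4 * F \<le> ?E\<^sup>2" by (simp add: dev)
  then have "sqrt (4 * F) \<le> ?E" using E0 by (intro real_le_lsqrt) auto
  then show "2 * sqrt F \<le> ?E" by (simp add: real_sqrt_mult)
  show "2 * sqrt F = ?E \<longleftrightarrow> (\<forall>r\<in>set rs. r ^ 3 = F * r)"
  proof
    assume E: "2 * sqrt F = ?E"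
    then have "?E\<^sup>2 = 4 * F" using F0 by (simp flip: E add: power_mult_distrib)
    then have "(\<Sum>r\<leftarrow>rs. \<bar>r\<bar> * (?E / 2 - \<bar>r\<bar>)) = 0" by (simp add: dev)
    then have "\<forall>r\<in>set rs. \<bar>r\<bar> * (?E / 2 - \<bar>r\<bar>) = 0"
      using half by (subst (asm) sum_list_nonneg_eq_0_iff) auto
    then have "\<forall>r\<in>set rs. r = 0 \<or> \<bar>r\<bar> = sqrt F" by (auto simp flip: E)
    then have "\<forall>r\<in>set rs. r = 0 \<or> r\<^sup>2 = F" using F0 by (metis power2_abs real_sqrt_pow2)
    then show "\<forall>r\<in>set rs. r ^ 3 = F * r" by (auto simp: power3_eq_cube power2_eq_square)
  next
    assume r3: "\<forall>r\<in>set rs. r ^ 3 = F * r"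
    have "\<bar>r\<bar> * sqrt F = r\<^sup>2" if "r \<in> set rs" for r
    proof (cases "r = 0")
      case False
      then have "r\<^sup>2 = F" using r3 that by (auto simp: power3_eq_cube power2_eq_square)
      then have "sqrt F = \<bar>r\<bar>" by auto
      then show ?thesis by (simp add: power2_eq_square)
    qed simp
    then have "(\<Sum>r\<leftarrow>rs. \<bar>r\<bar> * sqrt F) = (\<Sum>r\<leftarrow>rs. r\<^sup>2)"
      by (intro arg_cong[of _ _ sum_list] map_cong) auto
    then have EF: "?E * sqrt F = 2 * F" by (simp add: sq sum_list_mult_const)
    show "2 * sqrt F = ?E"
    \<comment> \<open>The factor \<open>sqrt F\<close> cancels only if \<open>F\<close> is nonzero.
      For \<open>F = 0\<close> the cubic equation makes every entry zero.\<close>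
    proof (cases "F = 0")
      case True
      then have "\<forall>r\<in>set rs. r = 0" using r3 by simp
      then have "?E = (\<Sum>r\<leftarrow>rs. 0)" by (intro arg_cong[of _ _ sum_list] map_cong) auto
      then show ?thesis using True by simp
    next
      case False
      have "?E * sqrt F = (2 * sqrt F) * sqrt F" using EF F0 by simp
      then show ?thesis using False by simp
    qed
  qed
qed

section \<open>The Sombor matrix indexed by vertices, and its spectral identities\<close>

definition sombor_weight :: "('a, 'b) pre_digraph \<Rightarrow> 'a \<Rightarrow> 'a \<Rightarrow> real" where
  "sombor_weight G u v =
    (if u \<rightarrow>\<^bsub>G\<^esub> v then sqrt ((real (out_degree G u))\<^sup>2 + (real (out_degree G v))\<^sup>2) else 0)"

context graph
begin

lemma dominates_sym: "u \<rightarrow> v \<Longrightarrow> v \<rightarrow> u"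
  using arcs_ends_symmetric[OF sym_arcs] by blast

text \<open>The degree counts arcs; without parallel arcs, an arc leaving \<open>u\<close> is
  determined by its head.\<close>

lemma out_degree_eq_card_neighbours: "out_degree G u = card {v. u \<rightarrow> v}"
proof -
  have "{v. u \<rightarrow> v} = head G ` out_arcs G u" by (auto simp: arcs_ends_conv)
  moreover have "inj_on (head G) (out_arcs G u)"
    by (auto intro!: inj_onI no_multi_arcs simp: arc_to_ends_def)
  ultimately show ?thesis by (simp add: out_degree_def card_image)
qed

lemma finite_neighbours: "finite {v. u \<rightarrow> v}"
  by (rule finite_subset[OF _ finite_verts]) (auto dest: adj_in_verts)

lemma out_degree_pos: "u \<rightarrow> v \<Longrightarrow> out_degree G u > 0"
  by (auto simp: out_degree_eq_card_neighbours card_gt_0_iff finite_neighbours)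

lemma sombor_weight_nonneg: "sombor_weight G u v \<ge> 0"
  by (simp add: sombor_weight_def)

text \<open>The ends of an edge have positive degree, so no edge gets weight 0. This is what lets
  positive sums of products of weights detect walks.\<close>

lemma sombor_weight_pos_iff: "sombor_weight G u v > 0 \<longleftrightarrow> u \<rightarrow> v"
  using out_degree_pos[of u v] by (auto simp: sombor_weight_def intro!: add_pos_nonneg)

lemma sombor_weight_commute: "sombor_weight G u v = sombor_weight G v u"
  using dominates_sym by (auto simp: sombor_weight_def add.commute)

lemma sombor_weight_same: "sombor_weight G u u = 0"
  by (auto simp: sombor_weight_def dest: adj_not_same)

lemma sum_dominates:
  "(\<Sum>v\<in>verts G. if u \<rightarrow> v then c else 0) = real (out_degree G u) * c"
proof -
  have "verts G \<inter> {v. u \<rightarrow> v} = {v. u \<rightarrow> v}" by (auto dest: adj_in_verts)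
  then show ?thesis by (simp add: sum.If_cases out_degree_eq_card_neighbours)
qed

text \<open>A squared weight splits into one square per end. Summing the squared degree of
  \<open>u\<close> over its neighbours gives the cube, and swapping the sums shows that the other
  end contributes the same total.\<close>

lemma sum_sombor_weight_squared:
  "(\<Sum>u\<in>verts G. \<Sum>v\<in>verts G. (sombor_weight G u v)\<^sup>2) =
    2 * (\<Sum>u\<in>verts G. real (out_degree G u) ^ 3)"
proof -
  let ?d = "\<lambda>u. real (out_degree G u)"
  have half: "(\<Sum>u\<in>verts G. \<Sum>v\<in>verts G. if u \<rightarrow> v then (?d u)\<^sup>2 else 0) = (\<Sum>u\<in>verts G. ?d u ^ 3)"
    by (simp add: sum_dominates power3_eq_cube power2_eq_square mult.assoc)
  have half': "(\<Sum>u\<in>verts G. \<Sum>v\<in>verts G. if u \<rightarrow> v then (?d v)\<^sup>2 else 0) = (\<Sum>u\<in>verts G. ?d u ^ 3)"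
  proof -
    have "(\<Sum>u\<in>verts G. \<Sum>v\<in>verts G. if u \<rightarrow> v then (?d v)\<^sup>2 else 0) =
        (\<Sum>v\<in>verts G. \<Sum>u\<in>verts G. if v \<rightarrow> u then (?d v)\<^sup>2 else 0)"
      using dominates_sym by (subst sum.swap) (intro sum.cong refl, auto)
    then show ?thesis using half by simp
  qed
  have "(sombor_weight G u v)\<^sup>2 =
      (if u \<rightarrow> v then (?d u)\<^sup>2 else 0) + (if u \<rightarrow> v then (?d v)\<^sup>2 else 0)" for u v
    by (simp add: sombor_weight_def)
  then show ?thesis by (simp add: sum.distrib half half')
qed

text \<open>The bridge from spectrum to graph: the equality cases become equations between weighted
  sums over walks of length 2 and 3, free of matrices and of the enumeration
  \<open>vs\<close>.\<close>

lemma sombor_energy_bounds_and_equality: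
  assumes vs: "distinct vs" "set vs = verts G" and n: "length vs = n" "n > 0"
    and F: "F = (\<Sum>v\<in>verts G. real (out_degree G v) ^ 3)"
  shows "2 * sqrt F \<le> sombor_energy G vs"
    and "sombor_energy G vs \<le> sqrt (2 * real n * F)"
    and "sombor_energy G vs = sqrt (2 * real n * F) \<longleftrightarrow>
      (\<forall>u\<in>verts G. \<forall>x\<in>verts G. (\<Sum>v\<in>verts G. sombor_weight G u v * sombor_weight G v x) =
        (if u = x then 2 * F / real n else 0))"
    and "2 * sqrt F = sombor_energy G vs \<longleftrightarrow>
      (\<forall>u\<in>verts G. \<forall>x\<in>verts G.
        (\<Sum>y\<in>verts G. (\<Sum>v\<in>verts G. sombor_weight G u v * sombor_weight G v y) * sombor_weight G y x) =
        F * sombor_weight G u x)"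
proof -
  let ?A = "sombor_mat G vs" and ?w = "sombor_weight G"
  have A: "?A \<in> carrier_mat n n" using sombor_mat_carrier n(1) by blast
  have ent: "?A $$ (i, j) = ?w (vs ! i) (vs ! j)" if "i < n" "j < n" for i j
    using that n(1) by (simp add: sombor_mat_def sombor_weight_def)
  have sym: "?A\<^sup>T = ?A"
    using A by (intro eq_matI) (auto simp: ent sombor_weight_commute)
  have "?A $$ (i, j) = ?A $$ (j, i)" if "i < n" "j < n" for i j
    using that by (simp add: ent sombor_weight_commute)
  from char_poly_symmetric_mat_splits[OF A this] obtain rs
    where rs: "char_poly ?A = (\<Prod>r\<leftarrow>rs. [:- r, 1:])" "length rs = n" by metis
  have energy: "sombor_energy G vs = (\<Sum>r\<leftarrow>rs. \<bar>r\<bar>)"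
    by (simp add: sombor_energy_def sombor_eigenvalues_def rs(1) proots_prod_list_linear
        sum_mset_sum_list flip: mset_map)
  have reindex: "(\<Sum>i<n. f (vs ! i)) = sum f (verts G)" for f :: "'a \<Rightarrow> real"
    using sum.reindex_bij_betw[OF bij_betw_nth[OF vs(1) refl], of "set vs" f] vs n(1) by simp
  have all: "(\<forall>i<n. \<forall>j<n. P (vs ! i) (vs ! j)) \<longleftrightarrow> (\<forall>u\<in>verts G. \<forall>x\<in>verts G. P u x)" for P
    using vs(2) n(1) by (metis in_set_conv_nth nth_mem)
  have pow: "?A ^\<^sub>m k \<in> carrier_mat n n" for k using A by simp
  have pow1: "?A ^\<^sub>m 1 = ?A" using A by simp
  have pow2: "(?A ^\<^sub>m 2) $$ (i, j) = (\<Sum>v\<in>verts G. ?w (vs ! i) v * ?w v (vs ! j))"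
    if "i < n" "j < n" for i j
  proof -
    have "?A ^\<^sub>m 2 = ?A * ?A" using A by (simp add: numeral_2_eq_2)
    then have "(?A ^\<^sub>m 2) $$ (i, j) = (\<Sum>k<n. ?w (vs ! i) (vs ! k) * ?w (vs ! k) (vs ! j))"
      using that index_mult_mat_sum[OF A A that] by (simp add: ent)
    then show ?thesis by (simp add: reindex[of "\<lambda>v. ?w (vs ! i) v * ?w v (vs ! j)"])
  qed
  have pow3: "(?A ^\<^sub>m 3) $$ (i, j) =
      (\<Sum>y\<in>verts G. (\<Sum>v\<in>verts G. ?w (vs ! i) v * ?w v y) * ?w y (vs ! j))"
    if "i < n" "j < n" for i j
  proof -
    have "?A ^\<^sub>m 3 = ?A ^\<^sub>m 2 * ?A" by (simp add: numeral_2_eq_2 numeral_3_eq_3)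
    then have "(?A ^\<^sub>m 3) $$ (i, j) =
        (\<Sum>k<n. (\<Sum>v\<in>verts G. ?w (vs ! i) v * ?w v (vs ! k)) * ?w (vs ! k) (vs ! j))"
      using that index_mult_mat_sum[OF pow A that, of 2] by (simp add: ent pow2)
    then show ?thesis
      by (simp add: reindex[of "\<lambda>y. (\<Sum>v\<in>verts G. ?w (vs ! i) v * ?w v y) * ?w y (vs ! j)"])
  qed
  have trace1: "(\<Sum>r\<leftarrow>rs. r) = 0"
  proof -
    have "(\<Sum>r\<leftarrow>rs. r) = mat_trace (?A ^\<^sub>m 1)"
      using mat_trace_pow_mat_eq_sum_eigenvalues[OF A rs(1), of 1] by simp
    also have "\<dots> = 0"
      unfolding pow1 using A by (simp add: mat_trace_def ent sombor_weight_same)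
    finally show ?thesis .
  qed
  have trace2: "(\<Sum>r\<leftarrow>rs. r\<^sup>2) = 2 * F"
  proof -
    have "(\<Sum>r\<leftarrow>rs. r\<^sup>2) = mat_trace (?A ^\<^sub>m 2)"
      using mat_trace_pow_mat_eq_sum_eigenvalues[OF A rs(1), of 2] by simp
    also have "\<dots> = (\<Sum>i<n. \<Sum>v\<in>verts G. ?w (vs ! i) v * ?w v (vs ! i))"
      using A by (simp add: mat_trace_def pow2)
    also have "\<dots> = (\<Sum>u\<in>verts G. \<Sum>v\<in>verts G. (?w u v)\<^sup>2)"
      unfolding reindex[of "\<lambda>u. \<Sum>v\<in>verts G. ?w u v * ?w v u"]
      by (metis (no_types, lifting) power2_eq_square sombor_weight_commute sum.cong)
    finally show ?thesis by (simp add: sum_sombor_weight_squared F)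
  qed
  show "2 * sqrt F \<le> sombor_energy G vs" "sombor_energy G vs \<le> sqrt (2 * real n * F)"
    unfolding energy
    using sum_list_abs_ge_sqrt(1)[OF trace1 trace2] sum_list_abs_le_sqrt(1)[OF rs(2) n(2) trace2]
    by auto
  \<comment> \<open>The factor \<open>r ^ 0\<close> fits the condition to
    \<open>symmetric_pow_mat_eq_iff\<close>; the zeroth matrix power is the identity, which makes
    the condition say that the square is scalar.\<close>
  have "sombor_energy G vs = sqrt (2 * real n * F) \<longleftrightarrow> (\<forall>r\<in>set rs. r ^ 2 = 2 * F / real n * r ^ 0)"
    unfolding energy using sum_list_abs_le_sqrt(2)[OF rs(2) n(2) trace2] by simp
  also have "\<dots> \<longleftrightarrow> (\<forall>i<n. \<forall>j<n. (?A ^\<^sub>m 2) $$ (i, j) = 2 * F / real n * (?A ^\<^sub>m 0) $$ (i, j))"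
    by (rule symmetric_pow_mat_eq_iff[OF A sym rs(1), symmetric])
  \<comment> \<open>As \<open>vs\<close> is distinct, equal positions amount to equal
    vertices.\<close>
  also have "\<dots> \<longleftrightarrow> (\<forall>i<n. \<forall>j<n. (\<Sum>v\<in>verts G. ?w (vs ! i) v * ?w v (vs ! j)) =
      (if vs ! i = vs ! j then 2 * F / real n else 0))"
    using A vs(1) n(1) by (simp add: pow2 nth_eq_iff_index_eq)
  finally show "sombor_energy G vs = sqrt (2 * real n * F) \<longleftrightarrow>
      (\<forall>u\<in>verts G. \<forall>x\<in>verts G. (\<Sum>v\<in>verts G. ?w u v * ?w v x) =
        (if u = x then 2 * F / real n else 0))"
    unfolding all[of "\<lambda>u x. (\<Sum>v\<in>verts G. ?w u v * ?w v x) = (if u = x then 2 * F / real n else 0)"] .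
  have "2 * sqrt F = sombor_energy G vs \<longleftrightarrow> (\<forall>r\<in>set rs. r ^ 3 = F * r ^ 1)"
    unfolding energy using sum_list_abs_ge_sqrt(2)[OF trace1 trace2] by simp
  also have "\<dots> \<longleftrightarrow> (\<forall>i<n. \<forall>j<n. (?A ^\<^sub>m 3) $$ (i, j) = F * (?A ^\<^sub>m 1) $$ (i, j))"
    by (rule symmetric_pow_mat_eq_iff[OF A sym rs(1), symmetric])
  also have "\<dots> \<longleftrightarrow> (\<forall>i<n. \<forall>j<n.
      (\<Sum>y\<in>verts G. (\<Sum>v\<in>verts G. ?w (vs ! i) v * ?w v y) * ?w y (vs ! j)) =
      F * ?w (vs ! i) (vs ! j))"
    unfolding pow1 by (simp add: pow3 ent)
  finally show "2 * sqrt F = sombor_energy G vs \<longleftrightarrow>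
      (\<forall>u\<in>verts G. \<forall>x\<in>verts G.
        (\<Sum>y\<in>verts G. (\<Sum>v\<in>verts G. ?w u v * ?w v y) * ?w y x) = F * ?w u x)"
    unfolding all[of "\<lambda>u x. (\<Sum>y\<in>verts G. (\<Sum>v\<in>verts G. ?w u v * ?w v y) * ?w y x) = F * ?w u x"] .
qed

section \<open>Isomorphism with edgeless graphs and with perfect matchings\<close>

lemma digraph_iso_edgeless_iff:
  assumes n: "card (verts G) = n"
  shows "digraph_iso G (with_proj (edgeless_graph n)) \<longleftrightarrow> arcs G = {}"
proof
  assume "digraph_iso G (with_proj (edgeless_graph n))"
  then obtain f where "with_proj (edgeless_graph n) = app_iso f G"
    by (auto simp: digraph_iso_def)
  from arg_cong[OF this, of arcs] show "arcs G = {}" by (simp add: edgeless_graph_def)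
next
  assume no_arcs: "arcs G = {}"
  obtain g where g: "bij_betw g (verts G) {..<n}"
    using n finite_verts by (metis ex_bij_betw_finite_nat lessThan_atLeast0)
  \<comment> \<open>No arc exists to be mapped, so \<open>undefined\<close> serves as the arc map;
    \<open>fst\<close> and \<open>snd\<close> must be the end maps because \<open>with_proj\<close>
    uses them and the records have to be equal.\<close>
  let ?f = "\<lparr>iso_verts = g, iso_arcs = undefined, iso_head = snd, iso_tail = fst\<rparr>"
  have "digraph_isomorphism ?f"
    using g wf_digraph by (simp add: digraph_isomorphism_def no_arcs bij_betw_def)
  moreover have "with_proj (edgeless_graph n) = app_iso ?f G"
    using g by (simp add: with_proj_def edgeless_graph_def app_iso_def no_arcs bij_betw_def)
  ultimately show "digraph_iso G (with_proj (edgeless_graph n))"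
    by (auto simp: digraph_iso_def)
qed

text \<open>If \<open>u\<close> goes to \<open>(k, a)\<close>, each neighbour must go to
  \<open>(k, \<not> a)\<close>, which gives uniqueness by injectivity. The arc between these two
  points is the image of an arc of the graph, which gives existence.\<close>

lemma perfect_matching_if_iso_copies_K2:
  assumes iso: "digraph_iso G (with_proj (copies_K2 m))" and u: "u \<in> verts G"
  shows "\<exists>!v. u \<rightarrow> v"
proof -
  from iso obtain f where f: "digraph_isomorphism f" and H: "with_proj (copies_K2 m) = app_iso f G"
    by (auto simp: digraph_iso_def)
  let ?g = "iso_verts f"
  have verts: "?g ` verts G = {..<m} \<times> UNIV"
    using arg_cong[OF H, of verts] by (simp add: copies_K2_def)
  have arcs: "iso_arcs f ` arcs G = {((k, a), (k, b)) | k a b. k < m \<and> a \<noteq> b}"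
    using arg_cong[OF H, of arcs] by (simp add: copies_K2_def)
  have ends: "fst (iso_arcs f e) = ?g (tail G e)" "snd (iso_arcs f e) = ?g (head G e)"
    if "e \<in> arcs G" for e
    using iso_verts_tail[OF f that] iso_verts_head[OF f that]
      arg_cong[OF H, of tail] arg_cong[OF H, of head] by simp_all
  have "?g u \<in> {..<m} \<times> UNIV" using verts u by blast
  then obtain k a where ka: "?g u = (k, a)" "k < m" by (cases "?g u") auto
  have inj: "x = y" if "?g x = ?g y" "x \<in> verts G" "y \<in> verts G" for x y
    using iso_verts_eq_iff[OF f that(2,3)] that(1) by blast
  have nb: "?g v = (k, \<not> a)" if uv: "u \<rightarrow> v" for v
  proof -
    obtain e where e: "e \<in> arcs G" "tail G e = u" "head G e = v"
      using uv by (auto simp: arcs_ends_conv)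
    have "iso_arcs f e \<in> {((k, a), (k, b)) | k a b. k < m \<and> a \<noteq> b}" using arcs e(1) by blast
    then show ?thesis using ends[OF e(1)] e ka by auto
  qed
  have "((k, a), (k, \<not> a)) \<in> iso_arcs f ` arcs G" unfolding arcs using ka(2) by auto
  then obtain e where e: "e \<in> arcs G" "iso_arcs f e = ((k, a), (k, \<not> a))" by auto
  have "tail G e = u" using ends(1)[OF e(1)] e ka(1) u by (intro inj) auto
  then have "u \<rightarrow> head G e" using e(1) by (auto simp: arcs_ends_conv)
  moreover have "v = head G e" if "u \<rightarrow> v" for v
    using nb[OF that] nb[OF calculation] that calculation by (intro inj) (auto dest: adj_in_verts)
  ultimately show ?thesis by blast
qed

lemma iso_copies_K2_if_perfect_matching:
  assumes pm: "\<And>u. u \<in> verts G \<Longrightarrow> \<exists>!v. u \<rightarrow> v"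
  shows "\<exists>m. card (verts G) = 2 * m \<and> digraph_iso G (with_proj (copies_K2 m))"
proof -
  define nb where "nb u = (THE v. u \<rightarrow> v)" for u
  have nb: "u \<rightarrow> v \<longleftrightarrow> v = nb u" if "u \<in> verts G" for u v
    using pm[OF that] unfolding nb_def by (metis the_equality)
  have nb_verts: "nb u \<in> verts G" if "u \<in> verts G" for u
    using nb[OF that] by (blast dest: adj_in_verts)
  have nb_nb: "nb (nb u) = u" if "u \<in> verts G" for u
    using nb[OF that, of "nb u"] nb[OF nb_verts[OF that]] dominates_sym by metis
  have nb_neq: "nb u \<noteq> u" if "u \<in> verts G" for u
    using nb[OF that] adj_not_same by metis
  define P where "P = (\<lambda>u. {u, nb u}) ` verts G"
  define m where "m = card P"
  have "finite P" by (simp add: P_def)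
  then obtain h where h: "bij_betw h P {..<m}"
    unfolding m_def by (metis ex_bij_betw_finite_nat lessThan_atLeast0)
  \<comment> \<open>\<open>c\<close> selects one vertex of each matched pair. The first coordinate
    of \<open>g\<close> numbers the pair, the second tells whether the vertex is the selected
    one.\<close>
  define c where "c e = (SOME u. u \<in> e)" for e :: "'a set"
  define g where "g u = (h {u, nb u}, u = c {u, nb u})" for u
  have c: "c {u, nb u} = u \<or> c {u, nb u} = nb u" for u
    unfolding c_def using someI[of "\<lambda>x. x \<in> {u, nb u}" u] by blast
  have pair_nb: "{nb u, nb (nb u)} = {u, nb u}" if "u \<in> verts G" for u
    using nb_nb[OF that] by auto
  have g_nb: "g (nb u) = (fst (g u), \<not> snd (g u))" if "u \<in> verts G" for u
    using c[of u] nb_neq[OF that] by (auto simp: g_def pair_nb[OF that])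
  have inj: "inj_on g (verts G)"
  proof (rule inj_onI)
    fix u v assume u: "u \<in> verts G" and v: "v \<in> verts G" and eq: "g u = g v"
    then have "{u, nb u} = {v, nb v}"
      using bij_betw_imp_inj_on[OF h] by (auto simp: g_def P_def dest: inj_onD)
    then have "v = u \<or> v = nb u" by auto
    \<comment> \<open>Partners share the pair number but differ in the Boolean, which excludes
      \<open>v = nb u\<close>.\<close>
    moreover have "g (nb u) \<noteq> g u" using g_nb[OF u] by (metis snd_conv)
    ultimately show "u = v" using eq by auto
  qed
  have img: "g ` verts G = {..<m} \<times> UNIV"
  proof (intro equalityI subsetI)
    fix p assume "p \<in> g ` verts G"
    then show "p \<in> {..<m} \<times> UNIV"
      using bij_betw_apply[OF h] by (auto simp: g_def P_def)
  next
    fix p :: "nat \<times> bool" assume "p \<in> {..<m} \<times> UNIV"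
    then obtain k b where p: "p = (k, b)" "k < m" by auto
    then have "k \<in> h ` P" using bij_betw_imp_surj_on[OF h] by simp
    then obtain u where u: "u \<in> verts G" "fst (g u) = k" by (auto simp: P_def g_def)
    show "p \<in> g ` verts G"
    proof (cases "snd (g u) = b")
      case True
      then have "p = g u" using u p by (simp add: prod_eq_iff)
      then show ?thesis using u(1) by blast
    next
      case False
      then have "p = g (nb u)" using u p g_nb[OF u(1)] by auto
      then show ?thesis using nb_verts[OF u(1)] by blast
    qed
  qed
  \<comment> \<open>Arcs of the target are pairs of vertices, so an arc must go to the pair of its
    image ends; this is injective because there are no parallel arcs.\<close>
  let ?a = "\<lambda>e. (g (tail G e), g (head G e))"
  let ?f = "\<lparr>iso_verts = g, iso_arcs = ?a, iso_head = snd, iso_tail = fst\<rparr>"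
  have "inj_on ?a (arcs G)"
    by (auto intro!: inj_onI no_multi_arcs simp: arc_to_ends_def inj_on_eq_iff[OF inj])
  then have "digraph_isomorphism ?f"
    using inj wf_digraph by (simp add: digraph_isomorphism_def)
  moreover have "?a ` arcs G = {((k, a), (k, b)) | k a b. k < m \<and> a \<noteq> b}"
  proof -
    have "?a ` arcs G = (\<lambda>(u, v). (g u, g v)) ` arcs_ends G"
      by (simp add: arcs_ends_conv image_image)
    also have "arcs_ends G = (\<lambda>u. (u, nb u)) ` verts G"
      using nb by (auto dest: adj_in_verts)
    also have "(\<lambda>(u, v). (g u, g v)) ` \<dots> = (\<lambda>p. (p, (fst p, \<not> snd p))) ` g ` verts G"
      by (auto simp: image_image g_nb intro!: image_cong)
    also have "\<dots> = {((k, a), (k, b)) | k a b. k < m \<and> a \<noteq> b}"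
      unfolding img by force
    finally show ?thesis .
  qed
  then have "with_proj (copies_K2 m) = app_iso ?f G"
    using img by (simp add: with_proj_def copies_K2_def app_iso_def)
  ultimately have "digraph_iso G (with_proj (copies_K2 m))"
    unfolding digraph_iso_def by blast
  moreover have "card (verts G) = 2 * m"
    using card_image[OF inj] by (simp add: img card_cartesian_product)
  ultimately show ?thesis by blast
qed

section \<open>Matrix equations read off walks of length 2 and 3\<close>

lemma sum_sombor_weight_path_pos:
  assumes "u \<rightarrow> v" "v \<rightarrow> x"
  shows "(\<Sum>v\<in>verts G. sombor_weight G u v * sombor_weight G v x) > 0"
proof (rule sum_pos2)
  show "v \<in> verts G" using assms by (blast dest: adj_in_verts)
  show "0 < sombor_weight G u v * sombor_weight G v x"
    using assms by (simp add: sombor_weight_pos_iff)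
qed (simp_all add: sombor_weight_nonneg)

lemma sombor_weight_square_scalar_iff:
  assumes n: "card (verts G) = n" "n > 0"
    and F: "F = (\<Sum>v\<in>verts G. real (out_degree G v) ^ 3)"
  shows "(\<forall>u\<in>verts G. \<forall>x\<in>verts G. (\<Sum>v\<in>verts G. sombor_weight G u v * sombor_weight G v x) =
      (if u = x then 2 * F / real n else 0)) \<longleftrightarrow>
    arcs G = {} \<or> (\<forall>u\<in>verts G. \<exists>!v. u \<rightarrow> v)"
    (is "?L \<longleftrightarrow> _")
proof
  assume L: ?L
  show "arcs G = {} \<or> (\<forall>u\<in>verts G. \<exists>!v. u \<rightarrow> v)"
  proof (subst disj_imp, intro impI ballI)
    fix u assume u: "u \<in> verts G" and "arcs G \<noteq> {}"
    then obtain a b where ab: "a \<rightarrow> b" by (auto simp: arcs_ends_conv)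
    have "F > 0"
      unfolding F using ab out_degree_pos[OF ab] by (intro sum_pos2[of _ a]) (auto dest: adj_in_verts)
    \<comment> \<open>All diagonal entries equal \<open>2 * F / real n\<close>, so a single edge
      anywhere gives every vertex a neighbour.\<close>
    then have "(\<Sum>v\<in>verts G. sombor_weight G u v * sombor_weight G v u) \<noteq> 0"
      using L u n(2) by simp
    then obtain v where "sombor_weight G u v * sombor_weight G v u \<noteq> 0"
      by (metis (no_types, lifting) sum.neutral)
    then have v: "u \<rightarrow> v" by (auto simp: sombor_weight_def split: if_splits)
    moreover have "x = v" if x: "u \<rightarrow> x" for x
    \<comment> \<open>A second neighbour \<open>x\<close> of \<open>u\<close> gives the walk from
      \<open>v\<close> through \<open>u\<close> to \<open>x\<close>, making positive an off-diagonal
      entry that should vanish.\<close>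
    proof (rule ccontr)
      assume neq: "x \<noteq> v"
      have "v \<in> verts G" "x \<in> verts G" using v x by (blast dest: adj_in_verts)+
      with L have "(\<Sum>y\<in>verts G. sombor_weight G v y * sombor_weight G y x) =
          (if v = x then 2 * F / real n else 0)" by blast
      then show False using sum_sombor_weight_path_pos[OF dominates_sym[OF v] x] neq by simp
    qed
    ultimately show "\<exists>!v. u \<rightarrow> v" by blast
  qed
next
  assume "arcs G = {} \<or> (\<forall>u\<in>verts G. \<exists>!v. u \<rightarrow> v)"
  then show ?L
  proof
    assume "arcs G = {}"
    then have no: "\<not> u \<rightarrow> v" for u v by (auto simp: arcs_ends_conv)
    then have "F = 0" by (simp add: F out_degree_eq_card_neighbours)
    then show ?L using no by (simp add: sombor_weight_def)
  next
    assume pm: "\<forall>u\<in>verts G. \<exists>!v. u \<rightarrow> v"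
    have deg: "out_degree G u = 1" if u: "u \<in> verts G" for u
    proof -
      obtain v where "{v. u \<rightarrow> v} = {v}" using pm u by blast
      then show ?thesis by (simp add: out_degree_eq_card_neighbours)
    qed
    \<comment> \<open>With all degrees 1, the scalar \<open>2 * F / real n\<close> is 2, the square
      of the common edge weight \<open>sqrt 2\<close>.\<close>
    then have "F = real n" by (simp add: F n)
    moreover have "(\<Sum>v\<in>verts G. sombor_weight G u v * sombor_weight G v x) = (if u = x then 2 else 0)"
      if u: "u \<in> verts G" for u x
    proof -
      have w: "sombor_weight G y z = (if y \<rightarrow> z then sqrt 2 else 0)" for y z
        using adj_in_verts deg by (auto simp: sombor_weight_def)
      obtain v where v: "u \<rightarrow> v" and uniq: "\<And>y. u \<rightarrow> y \<Longrightarrow> y = v" using pm u by blast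
      have vx: "v \<rightarrow> x \<longleftrightarrow> u = x" using pm v dominates_sym adj_in_verts by metis
      have "(\<Sum>v\<in>verts G. sombor_weight G u v * sombor_weight G v x) =
          (\<Sum>y\<in>{v}. sombor_weight G u y * sombor_weight G y x)"
      proof (rule sum.mono_neutral_right)
        show "{v} \<subseteq> verts G" using v adj_in_verts by blast
        show "\<forall>y\<in>verts G - {v}. sombor_weight G u y * sombor_weight G y x = 0"
        proof
          fix y assume "y \<in> verts G - {v}"
          then have "\<not> u \<rightarrow> y" using uniq by blast
          then show "sombor_weight G u y * sombor_weight G y x = 0" by (simp add: w)
        qed
      qed simp
      then show ?thesis using v vx by (simp add: w)
    qed
    ultimately show ?L using n(2) by simp
  qed
qed

lemma complete_bipartite_if_closed_under_3_paths:
  assumes conn: "Digraph_Component.connected G" and ne: "card (verts G) \<ge> 2"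
    and closed: "\<And>u v y x. u \<rightarrow> v \<Longrightarrow> v \<rightarrow> y \<Longrightarrow> y \<rightarrow> x \<Longrightarrow> u \<rightarrow> x"
  shows "\<exists>s t. s \<ge> 1 \<and> t \<ge> 1 \<and> s + t = card (verts G) \<and> complete_bipartite_digraph s t G"
proof -
  have reach: "u \<rightarrow>\<^sup>* v" if "u \<in> verts G" "v \<in> verts G" for u v
    using conn that reachable_mk_symmetric_eq[OF sym_arcs]
    by (auto simp: connected_def strongly_connected_def)
  obtain a b where ab: "a \<in> verts G" "b \<in> verts G" "a \<noteq> b"
    using ne card_le_Suc0_iff_eq[OF finite_verts] by fastforce
  \<comment> \<open>A walk between distinct vertices contains an arc; this is where two vertices are
    required.\<close>
  from reach[OF ab(1,2)] ab(3) obtain x y where xy: "x \<rightarrow> y"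
    by (induction rule: reachable_induct) auto
  define U where "U = {u. u \<rightarrow> y}"
  define V where "V = {v. x \<rightarrow> v}"
  have UV: "v \<in> V" if "u \<in> U" "u \<rightarrow> v" for u v
    \<comment> \<open>Apply \<open>closed\<close> to the walk \<open>x\<close>, \<open>y\<close>,
      \<open>u\<close>, \<open>v\<close>; for \<open>VU\<close> the walk is \<open>v\<close>,
      \<open>u\<close>, \<open>x\<close>, \<open>y\<close>.\<close>
    using that xy closed dominates_sym unfolding U_def V_def by blast
  have VU: "v \<in> U" if "u \<in> V" "u \<rightarrow> v" for u v
    using that xy closed dominates_sym unfolding U_def V_def by blast
  \<comment> \<open>A common element would form a triangle with \<open>x\<close> and
    \<open>y\<close>, a walk of length 3 from \<open>x\<close> to itself, and so force a
    loop.\<close>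
  have disj: "U \<inter> V = {}"
    using xy closed dominates_sym adj_not_same unfolding U_def V_def by blast
  have "u \<in> U \<union> V" if "u \<in> verts G" for u
  proof -
    have "x \<rightarrow>\<^sup>* u" using reach that xy by (blast dest: adj_in_verts)
    then show ?thesis
    proof (induction rule: reachable_induct)
      case base
      then show ?case using xy by (simp add: U_def)
    next
      case (step u v)
      then show ?case using UV VU by blast
    qed
  qed
  then have verts: "verts G = U \<union> V"
    unfolding U_def V_def by (auto dest: adj_in_verts)
  have "u \<rightarrow> v" if "u \<in> U" "v \<in> V" for u v
    \<comment> \<open>The walk here is \<open>u\<close>, \<open>y\<close>, \<open>x\<close>,
      \<open>v\<close>.\<close>
    using that xy closed dominates_sym unfolding U_def V_def by blast
  then have "U \<times> V \<union> V \<times> U \<subseteq> arcs_ends G" using dominates_sym by blast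
  moreover have "(u, v) \<in> U \<times> V \<union> V \<times> U" if "u \<rightarrow> v" for u v
  proof -
    have "u \<in> U \<union> V" using that adj_in_verts verts by blast
    then show ?thesis using UV VU that by blast
  qed
  ultimately have "arcs_ends G = U \<times> V \<union> V \<times> U" by (intro equalityI subrelI) blast+
  moreover have "finite U" "finite V" using finite_verts verts by simp_all
  moreover have "y \<in> V" "x \<in> U" using xy by (simp_all add: U_def V_def)
  moreover have "graph G" by unfold_locales
  ultimately show ?thesis
    using verts disj unfolding complete_bipartite_digraph_def
    by (intro exI[of _ "card U"] exI[of _ "card V"])
      (auto simp: card_Un_disjoint Suc_le_eq card_gt_0_iff)
qed

text \<open>Nothing cancels in the sum, so one walk of length 3 makes it positive; then the weight
  between its ends is nonzero.\<close>

lemma complete_bipartite_if_sombor_weight_cube: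
  assumes conn: "Digraph_Component.connected G" and n: "card (verts G) \<ge> 2"
    and cube: "\<And>u x. u \<in> verts G \<Longrightarrow> x \<in> verts G \<Longrightarrow>
      (\<Sum>y\<in>verts G. (\<Sum>v\<in>verts G. sombor_weight G u v * sombor_weight G v y) * sombor_weight G y x) =
      F * sombor_weight G u x"
  shows "\<exists>s t. s \<ge> 1 \<and> t \<ge> 1 \<and> s + t = card (verts G) \<and> complete_bipartite_digraph s t G"
proof (rule complete_bipartite_if_closed_under_3_paths[OF conn n])
  fix u v y x assume uv: "u \<rightarrow> v" and vy: "v \<rightarrow> y" and yx: "y \<rightarrow> x"
  have "(\<Sum>y\<in>verts G. (\<Sum>v\<in>verts G. sombor_weight G u v * sombor_weight G v y) * sombor_weight G y x) > 0"
  proof (rule sum_pos2)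
    show "y \<in> verts G" using yx by (blast dest: adj_in_verts)
    show "0 < (\<Sum>v\<in>verts G. sombor_weight G u v * sombor_weight G v y) * sombor_weight G y x"
      using sum_sombor_weight_path_pos[OF uv vy] yx by (simp add: sombor_weight_pos_iff)
  qed (simp_all add: sum_nonneg sombor_weight_nonneg)
  moreover have "u \<in> verts G" "x \<in> verts G" using uv yx by (blast dest: adj_in_verts)+
  ultimately have "F * sombor_weight G u x > 0" using cube by simp
  then show "u \<rightarrow> x" by (auto simp: sombor_weight_def split: if_splits)
qed

text \<open>Every edge joins degrees \<open>s\<close> and \<open>t\<close>, so all edges have the
  same weight \<open>c\<close>. The matrix is \<open>c\<close> times the adjacency matrix, whose
  cube is \<open>s * t\<close> times itself, and \<open>s * t * c^2\<close> is just
  \<open>F\<close>.\<close>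

lemma sombor_weight_cube_if_complete_bipartite:
  assumes K: "complete_bipartite_digraph s t G"
    and F: "F = (\<Sum>v\<in>verts G. real (out_degree G v) ^ 3)"
    and u: "u \<in> verts G"
  shows "(\<Sum>y\<in>verts G. (\<Sum>v\<in>verts G. sombor_weight G u v * sombor_weight G v y) * sombor_weight G y x) =
    F * sombor_weight G u x"
proof -
  from K obtain U V where verts: "verts G = U \<union> V" and disj: "U \<inter> V = {}"
    and card: "card U = s" "card V = t" and arcs: "arcs_ends G = U \<times> V \<union> V \<times> U"
    by (auto simp: complete_bipartite_digraph_def)
  have fin: "finite U" "finite V" using finite_verts verts by simp_all
  have "{v. u \<rightarrow> v} = V" if "u \<in> U" for u using that disj arcs by auto
  then have degU: "out_degree G u = t" if "u \<in> U" for u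
    using that card by (simp add: out_degree_eq_card_neighbours)
  have "{v. u \<rightarrow> v} = U" if "u \<in> V" for u using that disj arcs by auto
  then have degV: "out_degree G u = s" if "u \<in> V" for u
    using that card by (simp add: out_degree_eq_card_neighbours)
  define c where "c = sqrt ((real s)\<^sup>2 + (real t)\<^sup>2)"
  have w: "sombor_weight G u v = (if u \<in> U \<and> v \<in> V \<or> u \<in> V \<and> v \<in> U then c else 0)" for u v
    using degU degV by (auto simp: sombor_weight_def arcs c_def add.commute)
  have sum_verts: "sum f (verts G) = sum f U + sum f V" for f :: "'a \<Rightarrow> real"
    unfolding verts using fin disj by (rule sum.union_disjoint)
  \<comment> \<open>There are \<open>s\<close> vertices of degree \<open>t\<close> and
    \<open>t\<close> of degree \<open>s\<close>, so \<open>F\<close> is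
    \<open>s * t^3 + t * s^3\<close>.\<close>
  have F_eq: "F = real s * real t * c\<^sup>2"
    using card by (simp add: F sum_verts degU degV c_def power3_eq_cube power2_eq_square algebra_simps)
  have notV: "y \<notin> V" if "y \<in> U" for y using that disj by blast
  have notU: "y \<notin> U" if "y \<in> V" for y using that disj by blast
  have wU: "sombor_weight G v z = (if z \<in> V then c else 0)"
    "sombor_weight G z v = (if z \<in> V then c else 0)" if "v \<in> U" for v z
    using notV[OF that] that by (simp_all add: w)
  have wV: "sombor_weight G v z = (if z \<in> U then c else 0)"
    "sombor_weight G z v = (if z \<in> U then c else 0)" if "v \<in> V" for v z
    using notU[OF that] that by (simp_all add: w)
  \<comment> \<open>A walk of length 2 returns to its side; its midpoint is any vertex of the
    opposite side.\<close>
  have sq: "(\<Sum>v\<in>verts G. sombor_weight G u v * sombor_weight G v y) =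
      (if u \<in> U \<and> y \<in> U then real t * c\<^sup>2 else 0) +
      (if u \<in> V \<and> y \<in> V then real s * c\<^sup>2 else 0)" for y
    using card by (simp add: sum_verts wU wV power2_eq_square)
  consider "u \<in> U" | "u \<in> V" using u verts by blast
  then show ?thesis
  proof cases
    case 1
    then show ?thesis
      unfolding sq sum_verts F_eq using card by (simp add: wU notV notU)
  next
    case 2
    then show ?thesis
      unfolding sq sum_verts F_eq using card by (simp add: wV notV notU)
  qed
qed

end

theorem theorem4p2:
  fixes G :: "('a, 'b) pre_digraph" and vs :: "'a list" and n :: nat and F :: real
  assumes graph: "graph G"
    and vs: "distinct vs" "set vs = verts G"
    and n: "length vs = n" "n \<ge> 3"
    and F: "F = (\<Sum>v\<in>verts G. real (out_degree G v) ^ 3)"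
  shows "2 * sqrt F \<le> sombor_energy G vs \<and>
    sombor_energy G vs \<le> sqrt (2 * real n * F) \<and>
    (sombor_energy G vs = sqrt (2 * real n * F) \<longleftrightarrow>
      digraph_iso G (with_proj (edgeless_graph n)) \<or>
      (\<exists>m. n = 2 * m \<and> digraph_iso G (with_proj (copies_K2 m)))) \<and>
    (Digraph_Component.connected G \<longrightarrow>
      (2 * sqrt F = sombor_energy G vs \<longleftrightarrow>
        (\<exists>s t. s \<ge> 1 \<and> t \<ge> 1 \<and> s + t = n \<and> complete_bipartite_digraph s t G)))"
proof -
  interpret graph G by fact
  have card: "card (verts G) = n" using distinct_card[OF vs(1)] vs(2) n(1) by simp
  have n0: "n > 0" using n(2) by simp
  note spectral = sombor_energy_bounds_and_equality[OF vs n(1) n0 F]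
  have upper: "sombor_energy G vs = sqrt (2 * real n * F) \<longleftrightarrow>
      digraph_iso G (with_proj (edgeless_graph n)) \<or>
      (\<exists>m. n = 2 * m \<and> digraph_iso G (with_proj (copies_K2 m)))"
    unfolding spectral(3) sombor_weight_square_scalar_iff[OF card n0 F]
      digraph_iso_edgeless_iff[OF card]
    using perfect_matching_if_iso_copies_K2 iso_copies_K2_if_perfect_matching card by metis
  have lower: "2 * sqrt F = sombor_energy G vs \<longleftrightarrow>
      (\<exists>s t. s \<ge> 1 \<and> t \<ge> 1 \<and> s + t = n \<and> complete_bipartite_digraph s t G)"
    if conn: "Digraph_Component.connected G"
  proof
    assume "2 * sqrt F = sombor_energy G vs"
    \<comment> \<open>From \<open>n \<ge> 3\<close> come the two vertices required. A single vertex
      would attain equality, 0 on both sides, without having two nonempty sides.\<close>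
    then show "\<exists>s t. s \<ge> 1 \<and> t \<ge> 1 \<and> s + t = n \<and> complete_bipartite_digraph s t G"
      using complete_bipartite_if_sombor_weight_cube[OF conn, of F] n(2)
      unfolding spectral(4) card by auto
  next
    assume "\<exists>s t. s \<ge> 1 \<and> t \<ge> 1 \<and> s + t = n \<and> complete_bipartite_digraph s t G"
    then show "2 * sqrt F = sombor_energy G vs"
      unfolding spectral(4) using sombor_weight_cube_if_complete_bipartite[OF _ F] by blast
  qed
  from spectral(1,2) upper lower show ?thesis by blast
qed

end
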